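(* Let $(X,d)$ be a metric space, $\delta$ a semimetric on $X$, and $T\colon X\to X$ a multiplicative-type contraction: $$d(Tx,Ty)\,\delta(Tx,Ty)\le\beta\,d(x,y)\,\delta(x,y)\quad\text{for all }x,y\in X,$$ with $\beta\in[0,1)$. Suppose there exists a constant $K_*\ge1$ such that for all $x,y\in X$, $$\frac1{K_*}\,\delta(Tx,Ty)\le d(Tx,Ty)\le K_*\,\delta(Tx,Ty).$$ If $\beta<\frac{4K_*}{(K_*+1)^2}$, then $T$ is an A.M.-G.M. contraction: $$\frac{d(Tx,Ty)+\delta(Tx,Ty)}{2}\le\alpha\,\sqrt{d(x,y)\,\delta(x,y)}\quad\text{for all }x,y\in X,$$ with $\alpha=\frac{K_*+1}{2\sqrt{K_*}}\cdot\sqrt\beta\in[0,1)$.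
   Context: A semimetric on a nonempty set $X$ is a map $\delta\colon X\times X\to[0,\infty)$ such that $\delta(x,y)=0$ if and only if $x=y$, and $\delta(x,y)=\delta(y,x)$ for all $x,y\in X$ (no triangle inequality is required). *)

theory Defs
  imports "HOL-Analysis.Abstract_Metric_Spaces"
begin

definition semimetric_on :: "'a set \<Rightarrow> ('a \<Rightarrow> 'a \<Rightarrow> real) \<Rightarrow> bool" where
  "semimetric_on X \<delta> \<longleftrightarrow>
     X \<noteq> {} \<and>
     (\<forall>x\<in>X. \<forall>y\<in>X. 0 \<le> \<delta> x y) \<and>
     (\<forall>x\<in>X. \<forall>y\<in>X. \<delta> x y = 0 \<longleftrightarrow> x = y) \<and>
     (\<forall>x\<in>X. \<forall>y\<in>X. \<delta> x y = \<delta> y x)"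

text \<open>The two contraction notions carry their constant as a parameter and include
  its range \<open>[0, 1)\<close>.\<close>

definition multiplicative_contraction ::
  "'a set \<Rightarrow> ('a \<Rightarrow> 'a \<Rightarrow> real) \<Rightarrow> ('a \<Rightarrow> 'a \<Rightarrow> real) \<Rightarrow> real \<Rightarrow> ('a \<Rightarrow> 'a) \<Rightarrow> bool" where
  "multiplicative_contraction X d \<delta> \<beta> T \<longleftrightarrow>
     0 \<le> \<beta> \<and> \<beta> < 1 \<and>
     (\<forall>x\<in>X. \<forall>y\<in>X. d (T x) (T y) * \<delta> (T x) (T y) \<le> \<beta> * (d x y * \<delta> x y))"

definition am_gm_contraction ::
  "'a set \<Rightarrow> ('a \<Rightarrow> 'a \<Rightarrow> real) \<Rightarrow> ('a \<Rightarrow> 'a \<Rightarrow> real) \<Rightarrow> real \<Rightarrow> ('a \<Rightarrow> 'a) \<Rightarrow> bool" where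
  "am_gm_contraction X d \<delta> \<alpha> T \<longleftrightarrow>
     0 \<le> \<alpha> \<and> \<alpha> < 1 \<and>
     (\<forall>x\<in>X. \<forall>y\<in>X. (d (T x) (T y) + \<delta> (T x) (T y)) / 2 \<le> \<alpha> * sqrt (d x y * \<delta> x y))"

end

theory Submission
  imports Defs
begin

text \<open>Taking square roots in the multiplicative contraction shows that T shrinks the geometric
  mean of d and \<delta> by the factor \<open>sqrt \<beta>\<close>. It remains to pass from the
  arithmetic to the geometric mean of the two image distances. For positive a and b the quotient of
  these means depends only on a / b; when that ratio lies in [1/K, K], the quotient is largest at
  the endpoints, with value (K + 1) / (2 sqrt K). This reverse AM-GM inequality is
  \<open>am_le_gm_of_ratio_bounds\<close>. The constant \<alpha> is the product of the two
  factors.\<close>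

lemma am_le_gm_of_ratio_bounds:
  fixes a b K :: real
  assumes "K > 0" "a \<ge> 0" "b \<ge> 0" "b \<le> K * a" "a \<le> K * b"
  shows "(a + b) / 2 \<le> (K + 1) / (2 * sqrt K) * sqrt (a * b)"
proof -
  \<comment> \<open>Both factors are nonnegative by the ratio bounds. Expanding gives K (a^2 + b^2)
    \<le> (K^2 + 1) a b, and adding 2 K a b to both sides completes the two squares. No division by
    a or b occurs, so the case a = b = 0 is covered.\<close>
  have "0 \<le> (K * a - b) * (K * b - a)"
    using assms by simp
  then have "K * (a + b)\<^sup>2 \<le> (K + 1)\<^sup>2 * (a * b)"
    by (simp add: algebra_simps power2_eq_square)
  then have "sqrt (K * (a + b)\<^sup>2) \<le> sqrt ((K + 1)\<^sup>2 * (a * b))"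
    by (rule real_sqrt_le_mono)
  then have "sqrt K * (a + b) \<le> (K + 1) * sqrt (a * b)"
    using assms by (simp add: real_sqrt_mult)
  with \<open>K > 0\<close> show ?thesis
    by (simp add: field_simps)
qed

theorem theorem5p2:
  fixes X :: "'a set" and d \<delta> :: "'a \<Rightarrow> 'a \<Rightarrow> real" and T :: "'a \<Rightarrow> 'a"
    and \<beta> K :: real
  assumes "Metric_space X d"
    and "semimetric_on X \<delta>"
    and "T \<in> X \<rightarrow> X"
    and "multiplicative_contraction X d \<delta> \<beta> T"
    and "K \<ge> 1"
    and "\<And>x y. x \<in> X \<Longrightarrow> y \<in> X \<Longrightarrow>
           1 / K * \<delta> (T x) (T y) \<le> d (T x) (T y) \<and> d (T x) (T y) \<le> K * \<delta> (T x) (T y)"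
    and "\<beta> < 4 * K / (K + 1)\<^sup>2"
  shows "am_gm_contraction X d \<delta> ((K + 1) / (2 * sqrt K) * sqrt \<beta>) T"
  unfolding am_gm_contraction_def
proof (intro conjI ballI)
  have \<beta>: "0 \<le> \<beta>"
    using assms(4) by (simp add: multiplicative_contraction_def)
  show "0 \<le> (K + 1) / (2 * sqrt K) * sqrt \<beta>"
    using \<open>K \<ge> 1\<close> \<beta> by simp
  \<comment> \<open>Squaring removes the roots: the bound assumed on \<beta> says precisely that
    \<alpha>^2 < 1.\<close>
  have "((K + 1) / (2 * sqrt K) * sqrt \<beta>)\<^sup>2 = (K + 1)\<^sup>2 * \<beta> / (4 * K)"
    using \<open>K \<ge> 1\<close> \<beta> by (simp add: power_mult_distrib power_divide)
  also have "\<dots> < 1\<^sup>2"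
    using assms(7) \<open>K \<ge> 1\<close> by (simp add: field_simps)
  finally show "(K + 1) / (2 * sqrt K) * sqrt \<beta> < 1"
    by (rule power2_less_imp_less) simp
next
  fix x y assume xy: "x \<in> X" "y \<in> X"
  let ?a = "d (T x) (T y)" and ?b = "\<delta> (T x) (T y)"
  have "T x \<in> X" "T y \<in> X"
    using assms(3) xy by auto
  then have "?a \<ge> 0" "?b \<ge> 0"
    using Metric_space.nonneg[OF assms(1)] assms(2) by (auto simp: semimetric_on_def)
  moreover have "?b \<le> K * ?a" "?a \<le> K * ?b"
    using assms(6)[OF xy] \<open>K \<ge> 1\<close> by (auto simp: field_simps)
  ultimately have "(?a + ?b) / 2 \<le> (K + 1) / (2 * sqrt K) * sqrt (?a * ?b)"
    using \<open>K \<ge> 1\<close> by (intro am_le_gm_of_ratio_bounds) auto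
  \<comment> \<open>The product contraction enters here, under the square root; the prefactor is
    nonnegative, so monotonicity applies.\<close>
  also have "\<dots> \<le> (K + 1) / (2 * sqrt K) * sqrt (\<beta> * (d x y * \<delta> x y))"
    using assms(4) xy \<open>K \<ge> 1\<close>
    by (intro mult_left_mono real_sqrt_le_mono) (auto simp: multiplicative_contraction_def)
  also have "\<dots> = (K + 1) / (2 * sqrt K) * sqrt \<beta> * sqrt (d x y * \<delta> x y)"
    by (simp add: real_sqrt_mult)
  finally show "(?a + ?b) / 2 \<le> (K + 1) / (2 * sqrt K) * sqrt \<beta> * sqrt (d x y * \<delta> x y)" .
qed

end
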